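(* Let $1<x<y$ and $a,b,c\ge0$ be integers, let $v=a+b+c+1$, and suppose $L=\{1^a,x^b,y^c\}$ is strongly admissible. Let $\dot x=\min(\widehat{x^{-1}y},\widehat{x^{-1}})$, $\dot y=\max(\widehat{x^{-1}y},\widehat{x^{-1}})$, $\ddot x=\min(\widehat{y^{-1}},\widehat{xy^{-1}})$, $\ddot y=\max(\widehat{y^{-1}},\widehat{xy^{-1}})$, where inverses are taken modulo $v$. Define, for integers $1<p<s$, $$f(p,s)=\begin{cases} s-1 & \text{if } p \text{ and } s \text{ are even},\\ p+s-2 & \text{if } p=3, \text{ or } p \text{ is even and } s \text{ is odd},\\ p+s-1 & \text{otherwise.}\end{cases}$$ If $a\ge f(x,y)$, or $b\ge f(\dot x,\dot y)$, or $c\ge f(\ddot x,\ddot y)$, then $L$ is realizable. In particular, if $L$ is not realizable then $f(x,y)+f(\dot x,\dot y)+f(\ddot x,\ddot y)\ge v+2$.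
   Context: $K_v$ is the complete graph on vertex set $\{0,\dots,v-1\}$; the length of an edge $\{u,w\}$ is $\min(|u-w|,v-|u-w|)$. A multiset $L$ of size $v-1$ is realizable if some Hamiltonian path in $K_v$ has multiset of edge lengths equal to $L$. $\{x_1^{a_1},\dots\}$ denotes the multiset with $x_i$ of multiplicity $a_i$; $\mathrm{supp}(L)$ is its set of distinct elements. $L$ of size $v-1$ is strongly admissible if $\mathrm{supp}(L)\subseteq\{1,\dots,\lfloor v/2\rfloor\}$ and $\gcd(v,z)=1$ for all $z\in L$. For a nonzero residue $g$ modulo $v$ with representative $g'\in\{1,\dots,v-1\}$, $\widehat g=\min(g',v-g')$. *)

theory Defs
  imports "HOL-Library.Multiset" "HOL-Number_Theory.Number_Theory"
begin

definition complete_edges :: "nat \<Rightarrow> nat set set" where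
  "complete_edges v = {{u, w} | u w. u < v \<and> w < v \<and> u \<noteq> w}"

definition hamiltonian_path :: "nat \<Rightarrow> nat list \<Rightarrow> bool" where
  "hamiltonian_path v p \<longleftrightarrow>
     distinct p \<and> set p = {0..<v} \<and> successively (\<lambda>u w. {u, w} \<in> complete_edges v) p"

definition edge_length :: "nat \<Rightarrow> nat \<Rightarrow> nat \<Rightarrow> nat" where
  "edge_length v u w = (let d = nat \<bar>int u - int w\<bar> in min d (v - d))"

definition path_lengths :: "nat \<Rightarrow> nat list \<Rightarrow> nat multiset" where
  "path_lengths v p = mset (map (\<lambda>(u, w). edge_length v u w) (zip p (tl p)))"

text \<open>In the next two definitions the order \<open>v\<close> of the complete graph is recovered from
  \<open>size L = v - 1\<close>.\<close>

definition realizable :: "nat multiset \<Rightarrow> bool" where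
  "realizable L \<longleftrightarrow>
     (let v = size L + 1 in \<exists>p. hamiltonian_path v p \<and> path_lengths v p = L)"

definition strongly_admissible :: "nat multiset \<Rightarrow> bool" where
  "strongly_admissible L \<longleftrightarrow>
     (let v = size L + 1 in set_mset L \<subseteq> {1..v div 2} \<and> (\<forall>z\<in>#L. gcd v z = 1))"

text \<open>The representative of a residue class is taken in \<open>{0..<v}\<close>; for a nonzero class
  it lies in \<open>{1..v-1}\<close>.\<close>

definition hat :: "nat \<Rightarrow> int \<Rightarrow> nat" where
  "hat v g = (let g' = nat (g mod int v) in min g' (v - g'))"

text \<open>\<open>modular_inverse\<close> is \<open>0\<close> by convention on non-units. For \<open>z\<close> an element of a strongly admissible
  multiset of size \<open>v - 1\<close> it is a genuine inverse.\<close>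

abbreviation inv_mod :: "nat \<Rightarrow> nat \<Rightarrow> int" where
  "inv_mod v z \<equiv> modular_inverse (int v) (int z)"

text \<open>Only the values at \<open>1 < p < s\<close> are meaningful; there no subtraction is truncated.\<close>

definition f :: "nat \<Rightarrow> nat \<Rightarrow> nat" where
  "f p s = (if even p \<and> even s then s - 1
            else if p = 3 \<or> even p \<and> odd s then p + s - 2
            else p + s - 1)"

end

theory Submission
  imports Defs
begin

text \<open>
  Call a Hamiltonian path on \<open>0, \<dots>, n\<close> starting at \<open>0\<close> standard, and measure edges
  by ordinary differences. Standard paths for \<open>L\<close> and \<open>M\<close>, the first reflected and
  reversed, can be glued at a vertex to give a path for \<open>L + M\<close>. If \<open>m\<close> and \<open>m + 1\<close> are
  neighbours on a standard path and \<open>m + s\<close> is the first missing vertex, the detour through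
  \<open>m + s\<close> and \<open>m + 1 + s\<close> adds two edges of length \<open>s\<close>. Repeating this for the pairs
  in the top \<open>s\<close> vertices realizes any number of edges of length \<open>s\<close>, starting from
  \<open>s - 1\<close> edges of length \<open>1\<close>; if \<open>s\<close> is odd, one unpaired vertex is left over, which has to
  be the end of the path. When the number of such edges has the wrong parity, one produces a
  longer path and turns an edge of length \<open>s\<close> into one of length \<open>d < s\<close> by a rotation at
  its end. In the theorem the spare edge of length \<open>d = x\<close> is then taken from the other part.
  Multiplication by units modulo \<open>v\<close> permutes the roles of \<open>1, x, y\<close>. If \<open>b = 0\<close> or \<open>c = 0\<close>,
  one of the two multiplicities is at least the corresponding length \<open>y\<close> or \<open>hat v (inv_mod v y)\<close>,
  because these two lengths have sum at most \<open>v\<close>.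
\<close>

section \<open>Vertex lists, their steps and step lengths\<close>

definition steps :: "'a list \<Rightarrow> ('a \<times> 'a) list" where
  "steps p = zip p (tl p)"

definition dist_nat :: "nat \<Rightarrow> nat \<Rightarrow> nat" where
  "dist_nat u w = nat \<bar>int u - int w\<bar>"

definition step_lengths :: "nat list \<Rightarrow> nat multiset" where
  "step_lengths p = mset (map (\<lambda>(u, w). dist_nat u w) (steps p))"

definition std_path :: "nat multiset \<Rightarrow> nat list \<Rightarrow> bool" where
  "std_path L p \<longleftrightarrow> distinct p \<and> set p = {..size L} \<and> hd p = 0 \<and> step_lengths p = L"

definition std_linear :: "nat multiset \<Rightarrow> bool" where
  "std_linear L \<longleftrightarrow> (\<exists>p. std_path L p)"

text \<open>The start is left free because gluing two standard paths turns their common start into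
  an inner vertex in general.\<close>

definition linear_realizable :: "nat multiset \<Rightarrow> bool" where
  "linear_realizable L \<longleftrightarrow> (\<exists>p. distinct p \<and> set p = {..size L} \<and> step_lengths p = L)"

lemma steps_simps [simp]:
  "steps [] = []" "steps [u] = []" "steps (u # w # p) = (u, w) # steps (w # p)"
  by (simp_all add: steps_def)

lemma step_lengths_simps [simp]:
  "step_lengths [] = {#}" "step_lengths [u] = {#}" "step_lengths (u # w # p) = add_mset (dist_nat u w) (step_lengths (w # p))"
  by (simp_all add: step_lengths_def)

lemma dist_nat_commute: "dist_nat u w = dist_nat w u"
  by (simp add: dist_nat_def)

lemma dist_nat_le: "u \<le> w \<Longrightarrow> dist_nat u w = w - u" "w \<le> u \<Longrightarrow> dist_nat u w = u - w"
  by (auto simp: dist_nat_def)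

lemma steps_append:
  "p \<noteq> [] \<Longrightarrow> q \<noteq> [] \<Longrightarrow> steps (p @ q) = steps p @ (last p, hd q) # steps q"
proof (induction p)
  case (Cons u p)
  then show ?case by (cases p; cases q) auto
qed simp

lemma in_steps_appendI:
  "e \<in> set (steps p) \<Longrightarrow> e \<in> set (steps (p @ q))"
  "e \<in> set (steps q) \<Longrightarrow> e \<in> set (steps (p @ q))"
  by (cases "p = []"; cases "q = []"; simp add: steps_append)+

lemma steps_append_Cons: "steps (p @ u # q) = steps (p @ [u]) @ steps (u # q)"
  by (induction p rule: induct_list012) auto

lemma steps_map: "steps (map h p) = map (map_prod h h) (steps p)"
  by (induction p rule: induct_list012) auto

lemma steps_rev: "steps (rev p) = rev (map (\<lambda>(u, w). (w, u)) (steps p))"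
proof (induction p rule: induct_list012)
  case (3 u w p)
  then show ?case using steps_append_Cons[of "rev p" w "[u]"] by simp
qed auto

lemma in_steps_split:
  assumes "(u, w) \<in> set (steps p)"
  obtains us vs where "p = us @ u # w # vs"
  using assms
proof (induction p arbitrary: thesis rule: induct_list012)
  case (3 a b p)
  show ?case
  proof (cases "(a, b) = (u, w)")
    case True
    then show ?thesis using 3(3)[of "[]" p] by simp
  next
    case False
    then have "(u, w) \<in> set (steps (b # p))" using 3(4) by auto
    then obtain us vs where "b # p = us @ u # w # vs" using 3(2) by blast
    then show ?thesis using 3(3)[of "a # us" vs] by simp
  qed
qed auto

lemma set_steps_subset: "(u, w) \<in> set (steps p) \<Longrightarrow> u \<in> set p \<and> w \<in> set p"
  by (metis Un_iff in_steps_split list.set_intros(1,2) set_append)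

lemma distinct_steps_neq: "distinct p \<Longrightarrow> (u, w) \<in> set (steps p) \<Longrightarrow> u \<noteq> w"
  by (erule in_steps_split) auto

lemma step_lengths_append:
  "p \<noteq> [] \<Longrightarrow> q \<noteq> [] \<Longrightarrow> step_lengths (p @ q) = step_lengths p + add_mset (dist_nat (last p) (hd q)) (step_lengths q)"
  by (simp add: step_lengths_def steps_append)

lemma step_lengths_append_Cons: "step_lengths (p @ u # q) = step_lengths (p @ [u]) + step_lengths (u # q)"
  unfolding step_lengths_def by (subst steps_append_Cons) simp

lemma step_lengths_rev: "step_lengths (rev p) = step_lengths p"
  by (auto simp: step_lengths_def steps_rev rev_map[symmetric] case_prod_unfold dist_nat_commute o_def
      intro!: arg_cong[of _ _ mset])

lemma step_lengths_map:
  "(\<And>u w. u \<in> set p \<Longrightarrow> w \<in> set p \<Longrightarrow> dist_nat (h u) (h w) = dist_nat u w) \<Longrightarrow>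
    step_lengths (map h p) = step_lengths p"
  unfolding step_lengths_def steps_map map_map
  by (intro arg_cong[of _ _ mset] map_cong) (auto dest: set_steps_subset)

lemma steps_upt: "(u, w) \<in> set (steps [i..<j]) \<longleftrightarrow> w = Suc u \<and> i \<le> u \<and> w < j"
proof (induction j)
  case (Suc j)
  show ?case
  proof (cases "i < j")
    case True
    then show ?thesis using Suc steps_append[of "[i..<j]" "[j]"] by (auto simp: less_Suc_eq)
  qed auto
qed simp

lemma steps_rev_upt: "(u, w) \<in> set (steps (rev [i..<j])) \<longleftrightarrow> u = Suc w \<and> i \<le> w \<and> u < j"
  using steps_upt[of w u i j] by (auto simp: steps_rev)

lemma step_lengths_upt: "step_lengths [i..<j] = replicate_mset (j - Suc i) 1"
proof (induction j)
  case (Suc j)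
  show ?case
  proof (cases "i < j")
    case True
    then show ?thesis using Suc step_lengths_append[of "[i..<j]" "[j]"]
      by (simp add: dist_nat_def flip: Suc_diff_Suc)
  qed auto
qed simp

lemma step_lengths_rev_upt: "step_lengths (rev [i..<j]) = replicate_mset (j - Suc i) 1"
  by (simp only: step_lengths_rev step_lengths_upt)

section \<open>Standard paths: detours, extension, rotation, gluing\<close>

lemma std_path_nonempty: "std_path L p \<Longrightarrow> p \<noteq> []"
  by (auto simp: std_path_def)

text \<open>The step \<open>u, w\<close> becomes \<open>u, u + s, w + s, w\<close>: the unit step
  moves up by \<open>s\<close> and two steps of length \<open>s\<close> enter. The condition on
  \<open>min u w\<close> makes the new vertices the next two integers. The recorded steps are those
  on which later detours and rotations act.\<close>

lemma std_path_detour: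
  assumes p: "std_path L p" and uw: "(u, w) \<in> set (steps p)" "w = Suc u \<or> u = Suc w"
    and top: "min u w + s = Suc (size L)" and s: "s \<ge> 1"
  obtains p' where "std_path (L + replicate_mset 2 s) p'" "last p' = last p"
    "(u + s, w + s) \<in> set (steps p')" "(w + s, w) \<in> set (steps p')"
    "set (steps p) - {(u, w)} \<subseteq> set (steps p')"
proof -
  from uw(1) obtain us vs where split: "p = us @ u # w # vs" by (rule in_steps_split)
  define p' where "p' = us @ u # (u + s) # (w + s) # w # vs"
  have steps_p: "steps p = steps (us @ [u]) @ (u, w) # steps (w # vs)"
    unfolding split by (subst steps_append_Cons) simp
  have steps_p': "steps p' =
      steps (us @ [u]) @ (u, u + s) # (u + s, w + s) # (w + s, w) # steps (w # vs)"
    unfolding p'_def by (subst steps_append_Cons) simp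
  have "dist_nat u w = 1" using uw(2) by (auto simp: dist_nat_def)
  then have lens: "step_lengths p' = step_lengths p + replicate_mset 2 s"
    using uw(2) by (auto simp: step_lengths_def steps_p steps_p' dist_nat_def numeral_2_eq_2)
  have new: "{u + s, w + s} = {Suc (size L), Suc (Suc (size L))}"
    using uw(2) top by auto
  then have "u + s \<notin> set p" "w + s \<notin> set p"
    using p uw(2) top by (auto simp: std_path_def)
  then have "distinct p'" using p uw(2) unfolding std_path_def p'_def split by auto
  moreover have "set p' = set p \<union> {u + s, w + s}" unfolding p'_def split by auto
  then have "set p' = {..size (L + replicate_mset 2 s)}"
    using p unfolding std_path_def new by auto
  moreover have "hd p' = 0" using p unfolding std_path_def p'_def split by (cases us) auto
  ultimately have "std_path (L + replicate_mset 2 s) p'"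
    using p lens by (simp add: std_path_def)
  moreover have "last p' = last p" unfolding p'_def split by simp
  ultimately show ?thesis
    by (rule that) (auto simp: steps_p steps_p')
qed

text \<open>Meant for odd \<open>s\<close>, where the top vertex of a block of \<open>s\<close>
  vertices has no partner: the path ends there and is prolonged by one step of length
  \<open>s\<close>.\<close>

lemma std_path_append:
  assumes p: "std_path L p" and top: "last p + s = Suc (size L)"
  shows "std_path (L + {#s#}) (p @ [last p + s])"
    and "set (steps p) \<subseteq> set (steps (p @ [last p + s]))"
proof -
  note ne = std_path_nonempty[OF p]
  have p': "distinct p" "set p = {..size L}" "hd p = 0" "step_lengths p = L"
    using p by (simp_all add: std_path_def)
  have "last p + s \<notin> set p" unfolding p' top by simp
  then have "distinct (p @ [last p + s])" using p'(1) by simp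
  moreover have "set (p @ [last p + s]) = {..size (L + {#s#})}"
    unfolding set_append p' by (simp add: top atMost_Suc)
  moreover have "step_lengths (p @ [last p + s]) = L + {#s#}"
    using ne by (simp add: p' step_lengths_append dist_nat_def)
  moreover have "hd (p @ [last p + s]) = 0" using ne p'(3) by simp
  ultimately show "std_path (L + {#s#}) (p @ [last p + s])"
    unfolding std_path_def by blast
  show "set (steps p) \<subseteq> set (steps (p @ [last p + s]))"
    using ne by (auto simp: steps_append)
qed

text \<open>Reversing the part of the path after \<open>u\<close> trades the step from
  \<open>u\<close> to \<open>w\<close> for a step from \<open>u\<close> to the old end, and the
  start stays in place.\<close>

lemma std_path_rotate:
  assumes p: "std_path (L + {#dist_nat u w#}) p" and uw: "(u, w) \<in> set (steps p)"
  shows "std_linear (L + {#dist_nat (last p) u#})"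
proof -
  from uw obtain us vs where split: "p = us @ u # w # vs" by (rule in_steps_split)
  define q where "q = us @ u # rev (w # vs)"
  have "step_lengths p = step_lengths (us @ [u]) + add_mset (dist_nat u w) (step_lengths (w # vs))"
    unfolding split by (subst step_lengths_append_Cons) simp
  then have L: "L = step_lengths (us @ [u]) + step_lengths (w # vs)"
    using p by (simp add: std_path_def)
  have "step_lengths q = step_lengths ((us @ [u]) @ rev (w # vs))" by (simp add: q_def)
  also have "\<dots> = step_lengths (us @ [u]) + add_mset (dist_nat u (last p)) (step_lengths (w # vs))"
    unfolding split by (subst step_lengths_append) (simp_all add: step_lengths_rev hd_rev del: rev.simps)
  finally have "step_lengths q = L + {#dist_nat (last p) u#}"
    using L by (simp add: dist_nat_commute)
  moreover have "distinct q" "set q = set p" "hd q = hd p"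
    using p unfolding std_path_def q_def split by (auto simp: hd_append)
  ultimately show ?thesis using p unfolding std_linear_def std_path_def
    by (intro exI[of _ q]) simp
qed

lemma std_linear_add_one:
  assumes "std_linear L"
  shows "std_linear (L + {#1#})"
proof -
  from assms obtain p where p: "std_path L p" by (auto simp: std_linear_def)
  define q where "q = 0 # map Suc p"
  have ne: "p \<noteq> []" using std_path_nonempty[OF p] .
  have "step_lengths (map Suc p) = L"
    using p by (subst step_lengths_map) (auto simp: dist_nat_def std_path_def)
  moreover have "hd (map Suc p) = 1" using p ne by (simp add: std_path_def hd_map)
  ultimately have "step_lengths q = L + {#1#}"
    using step_lengths_append[of "[0]" "map Suc p"] ne by (simp add: q_def dist_nat_def)
  moreover have "distinct q" using p by (auto simp: q_def std_path_def distinct_map)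
  moreover have "set q = {..size (L + {#1#})}"
    using p by (auto simp: q_def std_path_def image_Suc_atMost)
  ultimately show ?thesis
    unfolding std_linear_def std_path_def by (intro exI[of _ q]) (simp add: q_def)
qed

lemma std_linear_add_ones:
  assumes "std_linear L"
  shows "std_linear (L + replicate_mset k 1)"
proof (induction k)
  case (Suc k)
  then show ?case using std_linear_add_one[OF Suc] by simp
qed (use assms in simp)

lemma linear_realizable_concat:
  assumes "std_linear L" "std_linear M"
  shows "linear_realizable (L + M)"
proof -
  from assms obtain p q where p: "std_path L p" and q: "std_path M q"
    by (auto simp: std_linear_def)
  define n where "n = size L"
  \<comment> \<open>Reflection sends the start 0 of \<open>p\<close> to \<open>n\<close>, which is
    also the start of the shifted \<open>q\<close>; \<open>tl\<close> drops the repeated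
    vertex.\<close>
  define r where "r = rev (map (\<lambda>i. n - i) p) @ tl (map (\<lambda>i. i + n) q)"
  have ne: "p \<noteq> []" "q \<noteq> []" using p q std_path_nonempty by auto
  have "hd q = 0" using q by (simp add: std_path_def)
  then obtain q' where q': "q = 0 # q'" using ne by (cases q) simp_all
  have sp: "set p = {..n}" using p by (simp add: std_path_def n_def)
  have "(\<lambda>i. n - i) ` {..n} = {..n}"
  proof
    show "{..n} \<subseteq> (\<lambda>i. n - i) ` {..n}"
    proof
      fix j assume "j \<in> {..n}"
      then show "j \<in> (\<lambda>i. n - i) ` {..n}" by (intro image_eqI[of _ _ "n - j"]) simp_all
    qed
  qed (simp add: image_subset_iff)
  then have set1: "set (map (\<lambda>i. n - i) p) = {..n}" by (simp only: set_map sp)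
  have sq: "set q' = {1..size M}" "distinct q'"
  proof -
    have "insert 0 (set q') = {..size M}" "0 \<notin> set q'"
      using q by (simp_all add: std_path_def q')
    then have "set q' = {..size M} - {0}" by blast
    also have "\<dots> = {1..size M}" by (auto simp: Suc_le_eq)
    finally show "set q' = {1..size M}" .
    show "distinct q'" using q by (simp add: std_path_def q')
  qed
  have set2: "set (map (\<lambda>i. i + n) q') = {n + 1..n + size M}"
    by (simp add: sq(1) image_add_atLeastAtMost' add.commute)
  have r: "r = rev (map (\<lambda>i. n - i) p) @ map (\<lambda>i. i + n) q'" by (simp add: r_def q')
  have "inj_on (\<lambda>i. n - i) (set p)" unfolding sp by (rule inj_onI) simp
  then have "distinct (rev (map (\<lambda>i. n - i) p))"
    using p by (simp add: distinct_map std_path_def)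
  moreover have "distinct (map (\<lambda>i. i + n) q')"
    using sq(2) by (simp add: distinct_map inj_on_def)
  moreover have "set (rev (map (\<lambda>i. n - i) p)) \<inter> set (map (\<lambda>i. i + n) q') = {}"
    unfolding set_rev set1 set2 by auto
  ultimately have "distinct r" unfolding r by (simp only: distinct_append)
  moreover have "set r = {..size (L + M)}"
  proof -
    have "set r = {..n} \<union> {n + 1..n + size M}"
      unfolding r set_append set_rev set1 set2 ..
    also have "\<dots> = {..size (L + M)}" by (auto simp: n_def)
    finally show ?thesis .
  qed
  moreover have "step_lengths r = L + M"
  proof -
    have hd: "hd p = 0" using p by (simp add: std_path_def)
    obtain p' where p': "p = 0 # p'" using hd ne by (cases p) simp_all
    have "step_lengths r = step_lengths (rev (map (\<lambda>i. n - i) p)) + step_lengths (map (\<lambda>i. i + n) q)"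
      unfolding r q' p'
      by (simp add: step_lengths_append_Cons[of "rev (map (\<lambda>i. n - i) p')" n "map (\<lambda>i. i + n) q'"])
    also have "step_lengths (map (\<lambda>i. i + n) q) = step_lengths q"
      by (rule step_lengths_map) (simp add: dist_nat_def)
    also have "step_lengths (rev (map (\<lambda>i. n - i) p)) = step_lengths p"
      unfolding step_lengths_rev by (rule step_lengths_map) (simp add: sp dist_nat_def)
    finally show ?thesis using p q by (simp add: std_path_def)
  qed
  ultimately show ?thesis unfolding linear_realizable_def by blast
qed

section \<open>Adding many edges of one length by repeated detours\<close>

definition top_paired :: "nat \<Rightarrow> nat \<Rightarrow> nat list \<Rightarrow> bool" where
  "top_paired s n p \<longleftrightarrow> (\<forall>m. n \<le> m + s \<and> Suc m < n \<and> even (n - m) \<longrightarrow>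
     (m, Suc m) \<in> set (steps p) \<or> (Suc m, m) \<in> set (steps p))"

lemma top_paired_mono: "top_paired s n p \<Longrightarrow> t \<le> s \<Longrightarrow> top_paired t n p"
  unfolding top_paired_def by (meson add_left_mono order_trans)

text \<open>Here \<open>n\<close> is the number of vertices. The detour uses the lowest pair among
  the top \<open>s\<close> vertices, breaks only its unit step and puts the pair
  \<open>n, n + 1\<close> on top, so the window of pairs moves up by two. Pairs are counted down
  from the top so that \<open>top_paired_mono\<close> can pass to a smaller length.\<close>

lemma grow_even_step:
  assumes s: "even s" "2 \<le> s" "s \<le> n" and n: "n = Suc (size L)"
    and p: "std_path L p" "top_paired s n p"
  shows "\<exists>p'. std_path (L + replicate_mset 2 s) p' \<and> top_paired s (n + 2) p'"
proof -
  define m where "m = n - s"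
  have "(m, Suc m) \<in> set (steps p) \<or> (Suc m, m) \<in> set (steps p)"
    using p(2) s unfolding top_paired_def m_def by auto
  then obtain u w where uw: "(u, w) \<in> set (steps p)" "{u, w} = {m, Suc m}"
    "w = Suc u \<or> u = Suc w"
    by blast
  have "min u w + s = Suc (size L)"
    using uw(2,3) s n by (auto simp: m_def doubleton_eq_iff)
  moreover have "1 \<le> s" using s by simp
  ultimately obtain p' where
    p': "std_path (L + replicate_mset 2 s) p'"
      "(u + s, w + s) \<in> set (steps p')" "set (steps p) - {(u, w)} \<subseteq> set (steps p')"
    using std_path_detour[OF p(1) uw(1,3)] by blast
  have "(k, Suc k) \<in> set (steps p') \<or> (Suc k, k) \<in> set (steps p')"
    if k: "n + 2 \<le> k + s" "Suc k < n + 2" "even (n + 2 - k)" for k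
  proof (cases "k = n")
    case True
    have "m + s = n" using s by (simp add: m_def)
    then have "(u + s, w + s) = (k, Suc k) \<or> (u + s, w + s) = (Suc k, k)"
      using uw(2) True by (auto simp: doubleton_eq_iff)
    then show ?thesis using p'(2) by metis
  next
    case False
    with k have "k < n" "even (n - k)" by (auto intro: Nat.gr0I)
    then have "Suc k < n" by (cases "Suc k = n") auto
    then have "(k, Suc k) \<in> set (steps p) \<or> (Suc k, k) \<in> set (steps p)"
      using p(2) k \<open>even (n - k)\<close> unfolding top_paired_def by auto
    moreover have "k > m" using k s by (simp add: m_def)
    then have "(u, w) \<noteq> (k, Suc k)" "(u, w) \<noteq> (Suc k, k)"
      using uw(2) by (auto simp: doubleton_eq_iff)
    ultimately show ?thesis using p'(3) by auto
  qed
  then have "top_paired s (n + 2) p'" unfolding top_paired_def by blast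
  then show ?thesis using p'(1) by blast
qed

lemma grow_even:
  assumes "even s" "2 \<le> s" "s \<le> n" "n = Suc (size L)"
    and "std_path L p" "top_paired s n p"
  shows "\<exists>p'. std_path (L + replicate_mset (2 * j) s) p' \<and> top_paired s (n + 2 * j) p'"
proof (induction j)
  case 0
  then show ?case using assms by auto
next
  case (Suc j)
  then obtain p' where p': "std_path (L + replicate_mset (2 * j) s) p'"
    "top_paired s (n + 2 * j) p'" by blast
  from grow_even_step[OF assms(1,2) _ _ p'] assms(3,4) show ?case
    by (simp add: numeral_2_eq_2)
qed

text \<open>In a directed pair \<open>{m, m + 1}\<close> created by a detour, the second vertex is followed by the
  vertex \<open>s\<close> below it; this edge is the one that a rotation removes.\<close>

definition oriented :: "bool \<Rightarrow> nat \<Rightarrow> nat list \<Rightarrow> bool" where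
  "oriented asc m p \<longleftrightarrow> (if asc then (m, Suc m) else (Suc m, m)) \<in> set (steps p)"

definition descends :: "bool \<Rightarrow> nat \<Rightarrow> nat \<Rightarrow> nat list \<Rightarrow> bool" where
  "descends asc s m p \<longleftrightarrow> (if asc then (Suc m, Suc m - s) else (m, m - s)) \<in> set (steps p)"

text \<open>Pairs are counted up from the bottom \<open>N - s\<close> of the top block, since for
  odd \<open>s\<close> the unpaired vertex has to be the top one. Each detour uses up a pair and
  creates its translate by \<open>s\<close>, traversed in the same direction. The last conjunct says
  that only unit steps get broken; it protects the edge that a later rotation removes.\<close>

lemma grow_pairs:
  assumes p: "std_path L p" and N: "N = Suc (size L)" and s: "2 \<le> s" "s \<le> N"
    and pairs: "\<And>i. even i \<Longrightarrow> i < s - 1 \<Longrightarrow> oriented asc (N - s + i) p"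
    and j: "2 * j \<le> s"
  shows "\<exists>p'. std_path (L + replicate_mset (2 * j) s) p' \<and> last p' = last p \<and>
    (\<forall>i. even i \<and> 2 * j \<le> i \<and> i < s - 1 \<longrightarrow> oriented asc (N - s + i) p') \<and>
    (\<forall>i. even i \<and> i < 2 * j \<longrightarrow> oriented asc (N + i) p' \<and> descends asc s (N + i) p') \<and>
    (\<forall>u w. (u, w) \<in> set (steps p) \<and> w \<noteq> Suc u \<and> u \<noteq> Suc w \<longrightarrow> (u, w) \<in> set (steps p'))"
  using j
proof (induction j)
  case 0
  then show ?case using p pairs by auto
next
  case (Suc j)
  then obtain q where q: "std_path (L + replicate_mset (2 * j) s) q" "last q = last p"
    and low: "\<And>i. even i \<Longrightarrow> 2 * j \<le> i \<Longrightarrow> i < s - 1 \<Longrightarrow> oriented asc (N - s + i) q"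
    and high: "\<And>i. even i \<Longrightarrow> i < 2 * j \<Longrightarrow> oriented asc (N + i) q \<and> descends asc s (N + i) q"
    and keep: "\<And>u w. (u, w) \<in> set (steps p) \<Longrightarrow> w \<noteq> Suc u \<Longrightarrow> u \<noteq> Suc w \<Longrightarrow> (u, w) \<in> set (steps q)"
    by auto
  define m where "m = N - s + 2 * j"
  define u w where "u = (if asc then m else Suc m)" and "w = (if asc then Suc m else m)"
  have uw: "(u, w) \<in> set (steps q)" "w = Suc u \<or> u = Suc w"
    using low[of "2 * j"] Suc.prems s by (auto simp: u_def w_def m_def oriented_def split: if_splits)
  have ms: "m + s = N + 2 * j" using s by (simp add: m_def)
  have "min u w + s = Suc (size (L + replicate_mset (2 * j) s))"
    using ms N by (auto simp: u_def w_def)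
  moreover have "1 \<le> s" using s by simp
  ultimately obtain p' where
    p': "std_path (L + replicate_mset (2 * j) s + replicate_mset 2 s) p'" "last p' = last q"
      "(u + s, w + s) \<in> set (steps p')" "(w + s, w) \<in> set (steps p')"
      "set (steps q) - {(u, w)} \<subseteq> set (steps p')"
    using std_path_detour[OF q(1) uw] by blast
  have keep': "(a, b) \<in> set (steps p')"
    if "(a, b) \<in> set (steps q)" "b \<noteq> Suc a" "a \<noteq> Suc b" for a b
    using that uw(2) p'(5) by auto
  have orient': "oriented asc k p'" if "oriented asc k q" "k \<noteq> m" for k
    using that p'(5) by (auto simp: oriented_def u_def w_def split: if_splits)
  have descend': "descends asc s (N + i) p'" if "descends asc s (N + i) q" for i
    using that s unfolding descends_def by (auto split: if_splits intro!: keep')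
  have new: "oriented asc (N + 2 * j) p'" "descends asc s (N + 2 * j) p'"
    using p'(3,4) unfolding ms[symmetric]
    by (auto simp: oriented_def descends_def u_def w_def split: if_splits)
  have "std_path (L + replicate_mset (2 * Suc j) s) p'"
    using p'(1) by (simp add: numeral_2_eq_2)
  moreover have "last p' = last p" using p'(2) q(2) by simp
  moreover have "oriented asc (N - s + i) p'" if "even i" "2 * Suc j \<le> i" "i < s - 1" for i
    using that by (intro orient' low) (auto simp: m_def)
  moreover have "oriented asc (N + i) p' \<and> descends asc s (N + i) p'" if "even i" "i < 2 * Suc j" for i
  proof (cases "i < 2 * j")
    case True
    then show ?thesis using that high[of i] Suc.prems s by (auto intro!: orient' descend' simp: m_def)
  next
    case False
    with that have "i = 2 * j" by (auto elim!: evenE)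
    then show ?thesis using new by simp
  qed
  moreover have "(a, b) \<in> set (steps p')"
    if "(a, b) \<in> set (steps p)" "b \<noteq> Suc a" "a \<noteq> Suc b" for a b
    using that keep keep' by blast
  ultimately show ?case by blast
qed

text \<open>A row is a block of \<open>s\<close> consecutive vertices. Once a row is full, the
  situation is the initial one translated by \<open>s\<close>: the same pairs, the same direction,
  and the end at the top vertex. Each row costs exactly \<open>s\<close> edges of length
  \<open>s\<close>.\<close>

lemma grow_rows:
  assumes s: "odd s" "3 \<le> s" "s \<le> N" and N: "N = Suc (size L)"
    and p: "std_path L p" "last p = N - 1"
    and pairs: "\<And>i. even i \<Longrightarrow> i < s - 1 \<Longrightarrow> oriented asc (N - s + i) p"
  shows "\<exists>p'. std_path (L + replicate_mset (q * s) s) p' \<and> last p' = N + q * s - 1 \<and>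
    (\<forall>i. even i \<and> i < s - 1 \<longrightarrow> oriented asc (N + q * s - s + i) p') \<and>
    (q \<ge> 1 \<longrightarrow> (\<forall>i. even i \<and> i < s - 1 \<longrightarrow> descends asc s (N + q * s - s + i) p'))"
proof (induction q)
  case 0
  then show ?case using p pairs by auto
next
  case (Suc q)
  then obtain r where r: "std_path (L + replicate_mset (q * s) s) r" "last r = N + q * s - 1"
    and r_pairs: "\<And>i. even i \<Longrightarrow> i < s - 1 \<Longrightarrow> oriented asc (N + q * s - s + i) r"
    by blast
  \<comment> \<open>So many detours fill the next row except for its top vertex, which the end of
    the path, lying \<open>s\<close> below it, then reaches.\<close>
  define j where "j = (s - 1) div 2"
  have j: "2 * j = s - 1" using s by (auto simp: j_def)
  obtain p1 where p1: "std_path (L + replicate_mset (q * s) s + replicate_mset (2 * j) s) p1"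
      "last p1 = last r"
    and high: "\<And>i. even i \<Longrightarrow> i < 2 * j \<Longrightarrow>
      oriented asc (N + q * s + i) p1 \<and> descends asc s (N + q * s + i) p1"
    using grow_pairs[OF r(1) _ _ _ r_pairs, where j = j] N s j by auto
  have last1: "last p1 + s = N + q * s + s - 1" using p1(2) r(2) N by simp
  have top: "last p1 + s = Suc (size (L + replicate_mset (q * s) s + replicate_mset (2 * j) s))"
    using last1 N j s by simp
  define p' where "p' = p1 @ [last p1 + s]"
  note ext = std_path_append[OF p1(1) top, folded p'_def]
  have "L + replicate_mset (q * s) s + replicate_mset (2 * j) s + {#s#} =
      L + replicate_mset (Suc q * s) s"
    using j s by (auto simp: multiset_eq_iff)
  then have "std_path (L + replicate_mset (Suc q * s) s) p'" using ext(1) by (simp only:)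
  moreover have "last p' = N + Suc q * s - 1" using last1 by (simp add: p'_def)
  moreover have "oriented asc (N + Suc q * s - s + i) p' \<and> descends asc s (N + Suc q * s - s + i) p'"
    if "even i" "i < s - 1" for i
    using high[OF that(1)] that(2) j ext(2) by (auto simp: oriented_def descends_def split: if_splits)
  ultimately show ?case by auto
qed

lemma grow_odd:
  assumes s: "odd s" "3 \<le> s" "s \<le> N" and N: "N = Suc (size L)"
    and p: "std_path L p" "last p = N - 1"
    and pairs: "\<And>i. even i \<Longrightarrow> i < s - 1 \<Longrightarrow> oriented asc (N - s + i) p"
    and j: "2 * j \<le> s"
  shows "\<exists>p'. std_path (L + replicate_mset (q * s + 2 * j) s) p' \<and> last p' = N + q * s - 1 \<and>
    (q \<ge> 1 \<longrightarrow> (\<forall>i. even i \<and> i < s - 1 \<longrightarrow> descends asc s (N + q * s - s + i) p'))"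
proof -
  obtain r where r: "std_path (L + replicate_mset (q * s) s) r" "last r = N + q * s - 1"
    and r_pairs: "\<And>i. even i \<Longrightarrow> i < s - 1 \<Longrightarrow> oriented asc (N + q * s - s + i) r"
    and desc: "\<And>i. q \<ge> 1 \<Longrightarrow> even i \<Longrightarrow> i < s - 1 \<Longrightarrow> descends asc s (N + q * s - s + i) r"
    using grow_rows[OF s N p pairs, where q = q] by blast
  obtain p' where p': "std_path (L + replicate_mset (q * s) s + replicate_mset (2 * j) s) p'"
      "last p' = last r"
    and keep: "\<And>u w. (u, w) \<in> set (steps r) \<Longrightarrow> w \<noteq> Suc u \<Longrightarrow> u \<noteq> Suc w \<Longrightarrow>
      (u, w) \<in> set (steps p')"
    using grow_pairs[OF r(1) _ _ _ r_pairs, where j = j] N s j by auto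
  have "descends asc s (N + q * s - s + i) p'" if "q \<ge> 1" "even i" "i < s - 1" for i
  proof -
    \<comment> \<open>The detours of the unfinished row break unit steps only. Once truncation is
      excluded, a descending step has length \<open>s\<close>, hence survives.\<close>
    have "s \<le> q * s" using that by simp
    then have "s \<le> N + q * s - s + i" using s by linarith
    then show ?thesis
      using desc[OF that] s unfolding descends_def
      by (cases asc) (simp_all, (rule keep; simp)+)
  qed
  moreover have "L + replicate_mset (q * s) s + replicate_mset (2 * j) s =
      L + replicate_mset (q * s + 2 * j) s"
    by (simp add: multiset_eq_iff)
  ultimately have "std_path (L + replicate_mset (q * s + 2 * j) s) p' \<and> last p' = N + q * s - 1 \<and>
      (q \<ge> 1 \<longrightarrow> (\<forall>i. even i \<and> i < s - 1 \<longrightarrow> descends asc s (N + q * s - s + i) p'))"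
    using p' r(2) by metis
  then show ?thesis by blast
qed

text \<open>One edge too many is built and then rotated into length \<open>d\<close>. The end is the
  top of the last full row, so the vertex \<open>d\<close> below it has offset
  \<open>s - 1 - d\<close> in that row, which has the parity of \<open>d\<close>. Descending steps
  leave from odd offsets if the pairs are traversed upward and from even offsets otherwise; hence
  the link between \<open>asc\<close> and \<open>d\<close>.\<close>

lemma grow_odd_rotate:
  assumes s: "odd s" "3 \<le> s" "s \<le> N" and N: "N = Suc (size L)"
    and p: "std_path L p" "last p = N - 1"
    and pairs: "\<And>i. even i \<Longrightarrow> i < s - 1 \<Longrightarrow> oriented asc (N - s + i) p"
    and j: "2 * j \<le> s" and q: "q \<ge> 1" and d: "1 \<le> d" "d < s" and asc: "asc \<longleftrightarrow> odd d"
  shows "std_linear (L + replicate_mset (q * s + 2 * j - 1) s + {#d#})"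
proof -
  obtain r where r: "std_path (L + replicate_mset (q * s + 2 * j) s) r" "last r = N + q * s - 1"
    and desc: "\<And>i. even i \<Longrightarrow> i < s - 1 \<Longrightarrow> descends asc s (N + q * s - s + i) r"
    using grow_odd[OF s N p pairs j, where q = q] q by blast
  define u where "u = N + q * s - 1 - d"
  have qs: "s \<le> q * s" using q by simp
  have u: "s \<le> u" using qs s d unfolding u_def by linarith
  have "(u, u - s) \<in> set (steps r)"
  proof (cases asc)
    case True
    \<comment> \<open>Otherwise \<open>u\<close> would be the bottom of the row, from which no
      descending step is supplied in this direction.\<close>
    then have "d \<noteq> s - 1" using s asc by auto
    with d have "d + 2 \<le> s" by simp
    moreover have "even (s - 2 - d)" using True asc s \<open>d + 2 \<le> s\<close> by auto
    ultimately have "descends asc s (N + q * s - s + (s - 2 - d)) r" using d by (intro desc) auto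
    moreover have "Suc (N + q * s - s + (s - 2 - d)) = u"
      using qs s d \<open>d + 2 \<le> s\<close> by (simp add: u_def)
    ultimately show ?thesis using True by (simp add: descends_def)
  next
    case False
    then have "even (s - 1 - d)" using asc s d by auto
    then have "descends asc s (N + q * s - s + (s - 1 - d)) r" using d by (intro desc) auto
    moreover have "N + q * s - s + (s - 1 - d) = u"
      using qs s d by (simp add: u_def)
    ultimately show ?thesis using False by (simp add: descends_def)
  qed
  moreover have "dist_nat u (u - s) = s" using u by (simp add: dist_nat_def)
  moreover have "dist_nat (last r) u = d" using r(2) qs s d by (simp add: u_def dist_nat_def)
  moreover have "L + replicate_mset (q * s + 2 * j) s =
      L + replicate_mset (q * s + 2 * j - 1) s + {#s#}"
    using qs s by (auto simp: multiset_eq_iff)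
  ultimately show ?thesis using std_path_rotate[of _ u "u - s" r] r(1) by metis
qed

section \<open>Starting paths, and linear realizations of up to three lengths\<close>

lemma std_path_upt:
  assumes "1 \<le> s"
  shows "std_path (replicate_mset (s - 1) 1) [0..<s]"
  using assms by (auto simp: std_path_def step_lengths_upt)

lemma std_path_fold:
  assumes "1 \<le> x" "x \<le> y"
  shows "std_path (replicate_mset (y - 1) 1 + {#x#}) ([0..<Suc (y - x)] @ rev [Suc (y - x)..<Suc y])"
    (is "std_path _ (?p @ ?q)")
proof -
  have "step_lengths (?p @ ?q) = step_lengths ?p + add_mset (dist_nat (last ?p) (hd ?q)) (step_lengths ?q)"
    using assms by (intro step_lengths_append) auto
  also have "last ?p = y - x" by simp
  also have "hd ?q = y" using assms by (simp add: hd_rev last_upt del: upt_Suc)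
  also have "dist_nat (y - x) y = x" using assms by (simp add: dist_nat_def)
  also have "step_lengths ?p = replicate_mset (y - x) 1" by (simp only: step_lengths_upt) simp
  also have "step_lengths ?q = replicate_mset (x - 1) 1"
    using assms by (simp only: step_lengths_rev_upt) simp
  finally have "step_lengths (?p @ ?q) = replicate_mset (y - 1) 1 + {#x#}"
    using assms by (auto simp: multiset_eq_iff)
  moreover have "set (?p @ ?q) = {..y}"
    unfolding set_append set_rev set_upt by (rule Set.set_eqI) (simp, linarith)
  moreover have "distinct (?p @ ?q)" by (simp add: disjoint_iff del: upt_Suc)
  moreover have "hd (?p @ ?q) = 0" by (simp add: hd_append del: upt_Suc)
  moreover have "size (replicate_mset (y - 1) 1 + {#x#}) = y" using assms by simp
  ultimately show ?thesis unfolding std_path_def by metis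
qed

lemma std_path_loop:
  assumes "2 \<le> x" "x \<le> y"
  shows "std_path (replicate_mset (y - 1) 1 + {#x, y#}) ([0] @ [x..<y + 2] @ [1..<x])"
proof -
  let ?q = "[x..<y + 2]" and ?r = "[1..<x]"
  have "step_lengths ([0] @ ?q @ ?r) =
      {#} + add_mset (dist_nat 0 x) (step_lengths ?q + add_mset (dist_nat (y + 1) 1) (step_lengths ?r))"
  proof -
    have "step_lengths ([0] @ ?q @ ?r) =
        step_lengths [0] + add_mset (dist_nat (last [0]) (hd (?q @ ?r))) (step_lengths (?q @ ?r))"
      using assms by (intro step_lengths_append) simp_all
    also have "step_lengths (?q @ ?r) =
        step_lengths ?q + add_mset (dist_nat (last ?q) (hd ?r)) (step_lengths ?r)"
      using assms by (intro step_lengths_append) simp_all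
    also have "hd (?q @ ?r) = x" using assms by (simp add: hd_append del: upt_Suc)
    also have "last ?q = y + 1" using assms by simp
    also have "hd ?r = 1" using assms by simp
    finally show ?thesis by simp
  qed
  also have "dist_nat 0 x = x" by (simp add: dist_nat_def)
  also have "dist_nat (y + 1) 1 = y" by (simp add: dist_nat_def)
  also have "step_lengths ?q = replicate_mset (y + 1 - x) 1" by (simp only: step_lengths_upt) simp
  also have "step_lengths ?r = replicate_mset (x - 2) 1" 
    by (simp only: step_lengths_upt) (simp add: numeral_2_eq_2)
  finally have "step_lengths ([0] @ ?q @ ?r) = replicate_mset (y - 1) 1 + {#x, y#}"
    using assms by (auto simp: multiset_eq_iff)
  moreover have "set ([0] @ ?q @ ?r) = {..y + 1}"
    unfolding set_append set_upt using assms by (intro Set.set_eqI) (simp, linarith)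
  moreover have "distinct ([0] @ ?q @ ?r)" using assms by auto
  moreover have "size (replicate_mset (y - 1) 1 + {#x, y#}) = y + 1" using assms by simp
  moreover have "hd ([0] @ ?q @ ?r) = 0" by simp
  ultimately show ?thesis unfolding std_path_def by metis
qed

text \<open>The four parities of \<open>b\<close> and \<open>c\<close> start from the paths \<open>0..y-1\<close>,
  \<open>0..y-x, y..y-x+1\<close>, the same with \<open>x = y\<close>, and \<open>0, x..y+1, 1..x-1\<close>.\<close>

lemma std_linear_even:
  assumes "even x" "even y" "2 \<le> x" "x \<le> y"
  shows "std_linear (replicate_mset (y - 1) 1 + replicate_mset b x + replicate_mset c y)"
proof -
  define i j where "i = b mod 2" and "j = c mod 2"
  define B where "B = replicate_mset (y - 1) 1 + replicate_mset i x + replicate_mset j y"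
  have size_B: "Suc (size B) = y + i + j" using assms by (simp add: B_def)
  have "\<exists>p. std_path B p \<and> top_paired y (y + i + j) p"
  proof -
    consider "i = 0" "j = 0" | "i = 1" "j = 0" | "i = 0" "j = 1" | "i = 1" "j = 1"
      unfolding i_def j_def by (meson mod2_eq_if)
    then show ?thesis
    proof cases
      case 1
      have "top_paired y y [0..<y]" by (auto simp: top_paired_def steps_upt)
      then show ?thesis using 1 assms std_path_upt[of y] unfolding B_def by (intro exI[of _ "[0..<y]"]) simp
    next
      case 2
      let ?p = "[0..<Suc (y - x)]" and ?q = "rev [Suc (y - x)..<Suc y]"
      have "top_paired y (Suc y) (?p @ ?q)"
        unfolding top_paired_def
      proof (intro allI impI)
        fix m assume m: "Suc y \<le> m + y \<and> Suc m < Suc y \<and> even (Suc y - m)"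
        then have "odd m" using assms by auto
        \<comment> \<open>Among consecutive integers the fold separates only \<open>y - x\<close>
          and \<open>y - x + 1\<close>, and these do not form one of the pairs, by parity.\<close>
        then have "m \<noteq> y - x" using assms by auto
        then have "(m, Suc m) \<in> set (steps ?p) \<or> (Suc m, m) \<in> set (steps ?q)"
          using m unfolding steps_upt steps_rev_upt by linarith
        then show "(m, Suc m) \<in> set (steps (?p @ ?q)) \<or> (Suc m, m) \<in> set (steps (?p @ ?q))"
          by (blast intro: in_steps_appendI)
      qed
      then show ?thesis using 2 assms std_path_fold[of x y] unfolding B_def
        by (intro exI[of _ "?p @ ?q"]) (simp del: upt_Suc)
    next
      case 3
      let ?p = "[0..<Suc (y - y)]" and ?q = "rev [Suc (y - y)..<Suc y]"
      have "top_paired y (Suc y) (?p @ ?q)"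
        unfolding top_paired_def
      proof (intro allI impI)
        fix m assume m: "Suc y \<le> m + y \<and> Suc m < Suc y \<and> even (Suc y - m)"
        then have "(Suc m, m) \<in> set (steps ?q)" unfolding steps_rev_upt by linarith
        then show "(m, Suc m) \<in> set (steps (?p @ ?q)) \<or> (Suc m, m) \<in> set (steps (?p @ ?q))"
          by (blast intro: in_steps_appendI)
      qed
      then show ?thesis using 3 assms std_path_fold[of y y] unfolding B_def
        by (intro exI[of _ "?p @ ?q"]) (simp del: upt_Suc)
    next
      case 4
      let ?q = "[x..<y + 2]" and ?r = "[1..<x]"
      have "top_paired y (y + 2) ([0] @ ?q @ ?r)"
        unfolding top_paired_def
      proof (intro allI impI)
        fix m assume m: "y + 2 \<le> m + y \<and> Suc m < y + 2 \<and> even (y + 2 - m)"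
        then have "even m" using assms by auto
        \<comment> \<open>The loop separates 0 from 1, which lie below the top \<open>y\<close>
          vertices, and \<open>x - 1\<close> from \<open>x\<close>, which do not form one of the
          pairs, by parity.\<close>
        then have "Suc m \<noteq> x" using assms by auto
        then have "(m, Suc m) \<in> set (steps ?q) \<or> (m, Suc m) \<in> set (steps ?r)"
          using m unfolding steps_upt by linarith
        then show "(m, Suc m) \<in> set (steps ([0] @ ?q @ ?r)) \<or> (Suc m, m) \<in> set (steps ([0] @ ?q @ ?r))"
          by (blast intro: in_steps_appendI)
      qed
      then show ?thesis using 4 assms std_path_loop[of x y] unfolding B_def
        by (intro exI[of _ "[0] @ ?q @ ?r"]) (simp add: add_mset_commute)
    qed
  qed
  then obtain p where p: "std_path B p" "top_paired y (y + i + j) p" by blast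
  define c' b' where "c' = 2 * (c div 2)" and "b' = 2 * (b div 2)"
  have y: "2 \<le> y" "y \<le> y + i + j" using assms by simp_all
  obtain q where q: "std_path (B + replicate_mset c' y) q" "top_paired y (y + i + j + c') q"
    using grow_even[OF assms(2) y size_B[symmetric] p] unfolding c'_def by blast
  \<comment> \<open>The longer length has been treated first: pairs in the top \<open>y\<close>
    vertices include those needed for \<open>x\<close>.\<close>
  have "top_paired x (y + i + j + c') q" using q(2) assms(4) by (rule top_paired_mono)
  moreover have "x \<le> y + i + j + c'" "y + i + j + c' = Suc (size (B + replicate_mset c' y))"
    using assms size_B by simp_all
  ultimately obtain r where "std_path (B + replicate_mset c' y + replicate_mset b' x) r"
    using grow_even[OF assms(1,3) _ _ q(1)] unfolding b'_def by blast
  moreover have "b = b' + i" "c = c' + j" by (simp_all add: b'_def c'_def i_def j_def)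
  then have "B + replicate_mset c' y + replicate_mset b' x =
      replicate_mset (y - 1) 1 + replicate_mset b x + replicate_mset c y"
    by (auto simp: B_def multiset_eq_iff)
  ultimately show ?thesis by (auto simp: std_linear_def)
qed

text \<open>Write \<open>c = q * s + r\<close> with \<open>r < s\<close>. Rows give
  \<open>q * s\<close> edges and detours an even number, which settles even \<open>r\<close>. For
  odd \<open>r\<close> the starting path must contain edges of length \<open>s\<close>, or one edge
  must be rotated. The rotation is reserved for \<open>q >= 1\<close> and \<open>r >= 3\<close>,
  which forces \<open>s > 3\<close>; this is why 3 is special in \<open>f\<close>.\<close>

lemma std_linear_odd:
  assumes s: "odd s" "3 \<le> s"
  shows "std_linear (replicate_mset (s - 1) 1 + replicate_mset c s) \<or>
    s \<noteq> 3 \<and> (\<forall>d\<in>{1..<s}. std_linear (replicate_mset (s - 1) 1 + replicate_mset c s + {#d#}))"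
proof -
  define A where "A = replicate_mset (s - 1) (1::nat)"
  \<comment> \<open>\<open>F\<close> is \<open>0, s, s - 1, ..., 1\<close>: one edge of length
    \<open>s\<close> and downward pairs, but the end is not the top vertex. Appending
    \<open>s + 1\<close> in \<open>G\<close> repairs this at the cost of a second such edge.\<close>
  define F where "F = [0] @ rev [1..<Suc s]"
  have path_A: "std_path A [0..<s]" using std_path_upt s by (simp add: A_def)
  have size_A: "s = Suc (size A)" and last_A: "last [0..<s] = s - 1"
    using s by (simp_all add: A_def)
  have pairs_A: "oriented True (s - s + i) [0..<s]" if "i < s - 1" for i
    using that by (simp add: oriented_def steps_upt)
  have path_F: "std_path (A + {#s#}) F"
    using std_path_fold[of s s] s by (simp add: A_def F_def)
  have F_steps: "(Suc m, m) \<in> set (steps F)" if "1 \<le> m" "m < s" for m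
    using that unfolding F_def by (intro in_steps_appendI(2)) (simp only: steps_rev_upt, simp)
  define G where "G = F @ [Suc s]"
  have "last F = 1" using s by (simp add: F_def last_rev del: upt_Suc)
  then have "last F + s = Suc (size (A + {#s#}))" using s by (simp add: A_def)
  from std_path_append[OF path_F this]
  have path_G: "std_path (A + {#s, s#}) G" and G_steps: "set (steps F) \<subseteq> set (steps G)"
    using \<open>last F = 1\<close> by (simp_all add: G_def)
  have size_F: "Suc s = Suc (size (A + {#s#}))" and size_G: "s + 2 = Suc (size (A + {#s, s#}))"
    and last_G: "last G = s + 2 - 1"
    using s by (simp_all add: A_def G_def)
  have pairs_F: "oriented False (Suc s - s + i) F" if "i < s - 1" for i
    using that F_steps by (simp add: oriented_def)
  have pairs_G: "oriented False (s + 2 - s + i) G" if "even i" "i < s - 1" for i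
  proof -
    \<comment> \<open>Parity excludes the pair \<open>s, s + 1\<close>, which is not joined in
      \<open>G\<close>.\<close>
    have "i + 2 < s" using that s by (cases "i + 2 = s") auto
    then show ?thesis using F_steps G_steps by (auto simp: oriented_def)
  qed
  define q r where "q = c div s" and "r = c mod s"
  have c: "c = q * s + r" and r: "r < s" using s by (simp_all add: q_def r_def)
  consider "even r" | "odd r" "q = 0" | "r = 1" "q \<ge> 1" | "odd r" "r \<ge> 3" "q \<ge> 1"
  proof -
    have "r = 1 \<or> r \<ge> 3" if "odd r" using that by (elim oddE) auto
    moreover have "q = 0 \<or> q \<ge> 1" by auto
    ultimately show ?thesis using that by blast
  qed
  then show ?thesis
  proof cases
    case 1
    then obtain j where j: "r = 2 * j" by (elim evenE)
    have "\<exists>p. std_path (A + replicate_mset (q * s + 2 * j) s) p"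
      using grow_odd[OF s order_refl size_A path_A last_A pairs_A, of j q] r j by auto
    then show ?thesis unfolding c j std_linear_def A_def by blast
  next
    case 2
    then obtain j where j: "r = 2 * j + 1" by (elim oddE)
    obtain p where p: "std_path (A + {#s#} + replicate_mset (2 * j) s) p"
      using grow_pairs[OF path_F size_F _ _ pairs_F, of j] s r j by auto
    have "A + {#s#} + replicate_mset (2 * j) s = A + replicate_mset c s"
      using 2 c j by simp
    then show ?thesis using p unfolding std_linear_def A_def by metis
  next
    case 3
    obtain j where j: "s = 2 * j + 1" using s(1) by (elim oddE)
    \<comment> \<open>The count is \<open>q * s + 1 = 2 + (q - 1) * s + (s - 1)\<close>: two edges
      in \<open>G\<close>, then \<open>q - 1\<close> rows, then all the detours of one more
      row.\<close>
    obtain p where p: "std_path (A + {#s, s#} + replicate_mset ((q - 1) * s + 2 * j) s) p"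
      using grow_odd[OF s _ size_G path_G last_G pairs_G, of j "q - 1"] j by auto
    have "c = 2 + ((q - 1) * s + 2 * j)" using 3 c j by (cases q) auto
    then have "A + {#s, s#} + replicate_mset ((q - 1) * s + 2 * j) s = A + replicate_mset c s"
      by (simp add: multiset_eq_iff)
    then show ?thesis using p unfolding std_linear_def A_def by metis
  next
    case 4
    then obtain j where j: "r = 2 * j + 1" by (elim oddE)
    \<comment> \<open>A path with \<open>c + 1\<close> edges of length \<open>s\<close> is rotated.
      The upward pairs of \<open>[0..<s]\<close> serve odd \<open>d\<close>, the downward pairs of
      \<open>G\<close> serve even \<open>d\<close>.\<close>
    have "std_linear (A + replicate_mset c s + {#d#})" if d: "1 \<le> d" "d < s" for d
    proof (cases "odd d")
      case True
      have "2 * (j + 1) \<le> s" using r j by simp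
      then have "std_linear (A + replicate_mset (q * s + 2 * (j + 1) - 1) s + {#d#})"
        by (intro grow_odd_rotate[OF s order_refl size_A path_A last_A pairs_A[of _] _ 4(3) d])
          (simp_all add: True)
      moreover have "q * s + 2 * (j + 1) - 1 = c" using c j by simp
      ultimately show ?thesis by (simp only:)
    next
      case False
      have "2 * j \<le> s" using r j by simp
      then have "std_linear (A + {#s, s#} + replicate_mset (q * s + 2 * j - 1) s + {#d#})"
        by (intro grow_odd_rotate[OF s _ size_G path_G last_G pairs_G _ 4(3) d])
          (simp_all add: False)
      moreover have "1 \<le> q * s" using 4 s by simp
      then have "c = 2 + (q * s + 2 * j - 1)" using c j by simp
      then have "A + {#s, s#} + replicate_mset (q * s + 2 * j - 1) s + {#d#} =
          A + replicate_mset c s + {#d#}"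
        by (simp add: multiset_eq_iff)
      ultimately show ?thesis by (simp only:)
    qed
    then show ?thesis using 4 r by (auto simp: A_def)
  qed
qed

text \<open>If only the second alternative of \<open>std_linear_odd\<close> is available, the extra
  edge is given length 1. This raises the bound from \<open>s - 1\<close> to
  \<open>s\<close>.\<close>

lemma std_linear_two:
  assumes "2 \<le> s" "(if even s \<or> s = 3 then s - 1 else s) \<le> a"
  shows "std_linear (replicate_mset a 1 + replicate_mset c s)"
proof -
  have shift: ?thesis if "std_linear (replicate_mset k 1 + replicate_mset c s)" "k \<le> a" for k
  proof -
    have "replicate_mset k 1 + replicate_mset c s + replicate_mset (a - k) 1 =
        replicate_mset a 1 + replicate_mset c s"
      using that(2) by (auto simp: multiset_eq_iff)
    then show ?thesis using std_linear_add_ones[OF that(1), of "a - k"] by (simp only:)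
  qed
  show ?thesis
  proof (cases "even s")
    case True
    then show ?thesis using std_linear_even[of s s 0 c] assms shift[of "s - 1"] by simp
  next
    case False
    then have "3 \<le> s" using assms(1) by (cases "s = 2") simp_all
    from std_linear_odd[OF False this, of c] show ?thesis
    proof
      assume "std_linear (replicate_mset (s - 1) 1 + replicate_mset c s)"
      then show ?thesis using assms(2) by (intro shift[of "s - 1"]) (auto split: if_splits)
    next
      assume *: "s \<noteq> 3 \<and>
        (\<forall>d\<in>{1..<s}. std_linear (replicate_mset (s - 1) 1 + replicate_mset c s + {#d#}))"
      then have "std_linear (replicate_mset (s - 1) 1 + replicate_mset c s + {#1#})"
        using \<open>3 \<le> s\<close> by simp
      moreover have "replicate_mset (s - 1) 1 + replicate_mset c s + {#1#} =
          replicate_mset s 1 + replicate_mset c s"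
        using \<open>3 \<le> s\<close> by (auto simp: multiset_eq_iff)
      ultimately have "std_linear (replicate_mset s 1 + replicate_mset c s)" by (simp only:)
      moreover have "s \<le> a" using * False assms(2) by simp
      ultimately show ?thesis by (rule shift)
    qed
  qed
qed

text \<open>If both lengths are even, a single standard path handles them together. Otherwise
  \<open>f x y\<close> is \<open>y - 1\<close> plus the bound of \<open>std_linear_two\<close> for
  \<open>x\<close>: a path for \<open>y\<close> with \<open>y - 1\<close> unit steps is glued to a
  path for \<open>x\<close> with the remaining ones.\<close>

lemma linear_realizable_three:
  assumes "1 < x" "x < y" "f x y \<le> a"
  shows "linear_realizable (replicate_mset a 1 + replicate_mset b x + replicate_mset c y)"
proof (cases "even x \<and> even y")
  case True
  then have "y - 1 \<le> a" using assms(3) by (simp add: f_def)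
  then have "replicate_mset (y - 1) 1 + replicate_mset b x + replicate_mset c y +
      replicate_mset (a - (y - 1)) 1 = replicate_mset a 1 + replicate_mset b x + replicate_mset c y"
    by (auto simp: multiset_eq_iff)
  moreover have "std_linear (replicate_mset (y - 1) 1 + replicate_mset b x + replicate_mset c y)"
    using True assms by (intro std_linear_even) simp_all
  ultimately have "std_linear (replicate_mset a 1 + replicate_mset b x + replicate_mset c y)"
    by (metis std_linear_add_ones)
  then show ?thesis unfolding std_linear_def std_path_def linear_realizable_def by blast
next
  case False
  define a' where "a' = a - (y - 1)"
  have a: "a = (y - 1) + a'" and a': "(if even x \<or> x = 3 then x - 1 else x) \<le> a'"
    using assms False by (auto simp: a'_def f_def split: if_splits)
  have y: "2 \<le> y" "y \<le> a" using a a' assms by (auto split: if_splits)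
  have x_part: "std_linear (replicate_mset a' 1 + replicate_mset b' x)" for b'
    using assms a' by (intro std_linear_two) simp_all
  have "std_linear (replicate_mset (y - 1) 1 + replicate_mset c y) \<or>
      std_linear (replicate_mset (y - 1) 1 + replicate_mset c y + {#x#})"
  proof (cases "even y")
    case True
    then show ?thesis using std_linear_even[of y y 0 c] y by simp
  next
    case False
    moreover have "3 \<le> y" using assms by simp
    ultimately show ?thesis using std_linear_odd[of y c] assms by auto
  qed
  then show ?thesis
  proof
    assume "std_linear (replicate_mset (y - 1) 1 + replicate_mset c y)"
    moreover have "replicate_mset (y - 1) 1 + replicate_mset c y +
        (replicate_mset a' 1 + replicate_mset b x) =
        replicate_mset a 1 + replicate_mset b x + replicate_mset c y"
      unfolding a by (simp add: multiset_eq_iff)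
    ultimately show ?thesis using linear_realizable_concat[OF _ x_part[of b]] by metis
  next
    assume y_part: "std_linear (replicate_mset (y - 1) 1 + replicate_mset c y + {#x#})"
    show ?thesis
    proof (cases b)
      \<comment> \<open>There is no edge of length \<open>x\<close> to lend to the first part; but
        \<open>a >= y\<close>, so \<open>std_linear_two\<close> applies to \<open>y\<close>
        alone.\<close>
      case 0
      have "std_linear (replicate_mset a 1 + replicate_mset c y)"
        using y by (intro std_linear_two) auto
      then show ?thesis using 0 unfolding std_linear_def std_path_def linear_realizable_def by auto
    next
      case (Suc b')
      have "replicate_mset (y - 1) 1 + replicate_mset c y + {#x#} +
          (replicate_mset a' 1 + replicate_mset b' x) =
          replicate_mset a 1 + replicate_mset b x + replicate_mset c y"
        unfolding a Suc by (simp add: multiset_eq_iff)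
      then show ?thesis using linear_realizable_concat[OF y_part x_part[of b']] by (simp only:)
    qed
  qed
qed

section \<open>Cyclic edge lengths and multiplication by units modulo \<open>v\<close>\<close>

lemma edge_length_dist_nat: "edge_length v u w = min (dist_nat u w) (v - dist_nat u w)"
  by (simp add: edge_length_def dist_nat_def Let_def)

lemma path_lengths_steps: "path_lengths v p = mset (map (\<lambda>(u, w). edge_length v u w) (steps p))"
  by (simp add: path_lengths_def steps_def)

lemma successively_steps: "successively P p \<longleftrightarrow> (\<forall>(u, w)\<in>set (steps p). P u w)"
  by (induction p rule: induct_list012) auto

lemma hamiltonian_path_iff: "hamiltonian_path v p \<longleftrightarrow> distinct p \<and> set p = {0..<v}"
proof -
  have "{u, w} \<in> complete_edges v"
    if "distinct p" "set p = {0..<v}" "(u, w) \<in> set (steps p)" for u w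
    using set_steps_subset[OF that(3)] distinct_steps_neq[OF that(1,3)] that(2)
    by (auto simp: complete_edges_def)
  then show ?thesis by (auto simp: hamiltonian_path_def successively_steps)
qed

text \<open>A difference of at most half of \<open>v\<close> is its own cyclic edge length.\<close>

lemma realizable_if_linear_realizable:
  assumes "linear_realizable L" "\<And>l. l \<in># L \<Longrightarrow> 2 * l \<le> Suc (size L)"
  shows "realizable L"
proof -
  obtain p where p: "distinct p" "set p = {..size L}" "step_lengths p = L"
    using assms(1) by (auto simp: linear_realizable_def)
  have "edge_length (Suc (size L)) u w = dist_nat u w" if "(u, w) \<in> set (steps p)" for u w
  proof -
    have "dist_nat u w \<in># step_lengths p" using that by (force simp: step_lengths_def)
    then have "2 * dist_nat u w \<le> Suc (size L)" unfolding p(3) by (rule assms(2))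
    then show ?thesis by (simp add: edge_length_dist_nat)
  qed
  then have "path_lengths (Suc (size L)) p = step_lengths p"
    unfolding path_lengths_steps step_lengths_def
    by (intro arg_cong[of _ _ mset] map_cong) auto
  moreover have "hamiltonian_path (Suc (size L)) p"
    using p by (simp add: hamiltonian_path_iff lessThan_Suc_atMost atLeast0LessThan)
  ultimately show ?thesis using p(3) by (auto simp: realizable_def)
qed

lemma hat_cong: "[g = h] (mod int v) \<Longrightarrow> hat v g = hat v h"
  by (simp add: hat_def cong_def)

lemma hat_minus: "0 < v \<Longrightarrow> hat v (- g) = hat v g"
proof -
  assume v: "0 < v"
  then have "0 \<le> g mod int v" "g mod int v < int v" by simp_all
  then show ?thesis
    by (auto simp: hat_def Let_def zmod_zminus1_eq_if nat_diff_distrib min_def)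
qed

lemma hat_cases:
  assumes "0 < v"
  shows "[int (hat v g) = g] (mod int v) \<or> [int (hat v g) = - g] (mod int v)"
proof -
  define r where "r = g mod int v"
  have r: "0 \<le> r" "r < int v" using assms by (simp_all add: r_def)
  then have "int (hat v g) = r \<or> int (hat v g) = int v - r"
    by (auto simp: hat_def Let_def r_def[symmetric] min_def)
  moreover have "[r = g] (mod int v)" by (simp add: r_def cong_def)
  moreover from this have "[int v - r = - g] (mod int v)"
    using cong_diff[of "int v" 0 "int v" r g] by (simp add: cong_def[of "int v" 0])
  ultimately show ?thesis by metis
qed

text \<open>Inside, \<open>hat v g\<close> is \<open>g\<close> or \<open>- g\<close> modulo
  \<open>v\<close>; outside, \<open>hat\<close> forgets the sign.\<close>

lemma hat_mult_hat: "0 < v \<Longrightarrow> hat v (k * int (hat v g)) = hat v (k * g)"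
  using hat_cases[of v g]
proof
  assume "[int (hat v g) = g] (mod int v)"
  then show ?thesis by (intro hat_cong cong_scalar_left)
next
  assume v: "0 < v" and "[int (hat v g) = - g] (mod int v)"
  then have "hat v (k * int (hat v g)) = hat v (k * (- g))" by (intro hat_cong cong_scalar_left)
  then show ?thesis using hat_minus[OF v, of "k * g"] by simp
qed simp_all

lemma hat_of_nat: "0 < v \<Longrightarrow> 2 * l \<le> v \<Longrightarrow> hat v (int l) = l"
  by (simp add: hat_def nat_mod_distrib)

lemma hat_bound: "2 * hat v g \<le> v"
  unfolding hat_def Let_def min_def by (split if_split) linarith

lemma edge_length_hat:
  assumes "u < v" "w < v"
  shows "edge_length v u w = hat v (int u - int w)"
proof (cases "w \<le> u")
  case True
  then have "nat ((int u - int w) mod int v) = u - w" using assms by (simp add: of_nat_diff flip: of_nat_diff)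
  then show ?thesis using True by (simp add: hat_def edge_length_dist_nat dist_nat_le)
next
  case False
  then have "nat ((int w - int u) mod int v) = w - u" using assms by (simp flip: of_nat_diff)
  then have "hat v (int w - int u) = edge_length v u w"
    using False by (simp add: hat_def edge_length_dist_nat dist_nat_le)
  then show ?thesis using hat_minus[of v "int w - int u"] assms by simp
qed

text \<open>Multiplication by a unit permutes the residues modulo \<open>v\<close>, hence the
  vertices, and multiplies all differences by that unit.\<close>

lemma realizable_scale:
  assumes L: "realizable L" and v: "v = size L + 1" and k: "coprime k (int v)"
  shows "realizable (image_mset (\<lambda>l. hat v (k * int l)) L)"
proof -
  obtain p where p: "distinct p" "set p = {0..<v}" "path_lengths v p = L"
    using L by (auto simp: realizable_def Let_def v hamiltonian_path_iff)
  define h where "h i = nat ((k * int i) mod int v)" for i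
  have v0: "0 < v" by (simp add: v)
  have h_cong: "[int (h i) = k * int i] (mod int v)" and h_less: "h i < v" for i
    using v0 by (simp_all add: h_def nat_less_iff cong_def)
  have "inj_on h {0..<v}"
  proof (rule inj_onI)
    fix i j assume ij: "i \<in> {0..<v}" "j \<in> {0..<v}" "h i = h j"
    then have "[k * int i = k * int j] (mod int v)"
      using h_cong[of i] h_cong[of j] by (metis cong_sym cong_trans)
    then have "[int i = int j] (mod int v)" using k by (simp add: cong_mult_lcancel)
    then have "[i = j] (mod v)" by (simp add: cong_int_iff)
    then show "i = j" using ij(1,2) by (simp add: cong_less_modulus_unique_nat)
  qed
  moreover have "h ` {0..<v} \<subseteq> {0..<v}" using h_less by auto
  ultimately have "h ` {0..<v} = {0..<v}" by (intro endo_inj_surj) simp_all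
  with \<open>inj_on h {0..<v}\<close> p have "hamiltonian_path v (map h p)"
    by (simp add: hamiltonian_path_iff distinct_map)
  moreover have "edge_length v (h u) (h w) = hat v (k * int (edge_length v u w))"
    if "(u, w) \<in> set (steps p)" for u w
  proof -
    have uw: "u < v" "w < v" using set_steps_subset[OF that] p(2) by simp_all
    have "[int (h u) - int (h w) = k * int u - k * int w] (mod int v)"
      by (intro cong_diff h_cong)
    then have "hat v (int (h u) - int (h w)) = hat v (k * (int u - int w))"
      by (intro hat_cong) (simp add: right_diff_distrib)
    then show ?thesis
      using uw h_less v0 by (simp add: edge_length_hat hat_mult_hat)
  qed
  then have "path_lengths v (map h p) = image_mset (\<lambda>l. hat v (k * int l)) (path_lengths v p)"
    unfolding path_lengths_steps steps_map mset_map[symmetric] map_map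
    by (intro arg_cong[of _ _ mset] map_cong) auto
  ultimately show ?thesis using v p(3) by (auto simp: realizable_def Let_def)
qed

lemma hat_inverse:
  assumes "0 < v" "[k' * k = 1] (mod int v)" "2 * l \<le> v"
  shows "hat v (k' * int (hat v (k * int l))) = l"
proof -
  have "hat v (k' * int (hat v (k * int l))) = hat v (k' * (k * int l))"
    using assms(1) by (rule hat_mult_hat)
  also have "\<dots> = hat v (int l)"
    using cong_scalar_right[OF assms(2), of "int l"] by (intro hat_cong) (simp add: mult.assoc)
  also have "\<dots> = l" using assms(1,3) by (rule hat_of_nat)
  finally show ?thesis .
qed

text \<open>Scaling by \<open>k'\<close> undoes scaling by \<open>k\<close>, since
  \<open>hat\<close> fixes lengths of at most half of \<open>v\<close>. Thus it suffices to realize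
  a convenient multiple of \<open>L\<close>.\<close>

lemma realizable_unscale:
  assumes L: "realizable (image_mset (\<lambda>l. hat v (k * int l)) L)" and v: "v = size L + 1"
    and k: "[k' * k = 1] (mod int v)" and small: "\<And>l. l \<in># L \<Longrightarrow> 2 * l \<le> v"
  shows "realizable L"
proof -
  have "coprime k' (int v)" using k by (metis coprime_iff_invertible_int)
  then have "realizable (image_mset (\<lambda>l. hat v (k' * int l)) (image_mset (\<lambda>l. hat v (k * int l)) L))"
    using realizable_scale[OF L] v by simp
  moreover have "image_mset (\<lambda>l. hat v (k' * int (hat v (k * int l)))) L = image_mset (\<lambda>l. l) L"
    using small v by (intro image_mset_cong hat_inverse[OF _ k]) simp_all
  ultimately show ?thesis by (simp add: image_mset.compositionality o_def)
qed

section \<open>Realizability for two and three lengths\<close>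

lemma realizable_two:
  assumes y: "1 < y" "2 * y \<le> v" "coprime y v" and v: "v = a + c + 1"
  shows "realizable (replicate_mset a 1 + replicate_mset c y)"
proof -
  have direct: "realizable (replicate_mset m 1 + replicate_mset n z)"
    if "1 < z" "2 * z \<le> v" "z \<le> m" "m + n + 1 = v" for m n z
  proof -
    have "std_linear (replicate_mset m 1 + replicate_mset n z)"
      using that by (intro std_linear_two) auto
    then have "linear_realizable (replicate_mset m 1 + replicate_mset n z)"
      unfolding std_linear_def std_path_def linear_realizable_def by blast
    then show ?thesis
    proof (rule realizable_if_linear_realizable)
      fix l assume "l \<in># replicate_mset m 1 + replicate_mset n z"
      then have "l = 1 \<or> l = z" by (auto split: if_splits)
      then show "2 * l \<le> Suc (size (replicate_mset m 1 + replicate_mset n z))"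
        using that by simp linarith
    qed
  qed
  show ?thesis
  proof (cases "y \<le> a")
    case True
    then show ?thesis using direct[of y a c] y v by simp
  next
    case False
    \<comment> \<open>Multiplication by the inverse of \<open>y\<close> turns \<open>y\<close> into
      1 and 1 into \<open>z\<close>, so \<open>c\<close> becomes the number of unit steps.\<close>
    define k where "k = inv_mod v y"
    have v0: "0 < v" by (simp add: v)
    have k: "[int y * k = 1] (mod int v)"
      using y(3) unfolding k_def by (intro cong_modular_inverse1) simp
    define z where "z = hat v k"
    have "hat v (int y * int (hat v (k * int 1))) = 1" using y v0 k by (intro hat_inverse) simp_all
    then have z_inv: "hat v (int y * int z) = 1" by (simp add: z_def)
    have "z \<noteq> 0" using z_inv by (intro notI) (simp add: hat_def)
    moreover have "z \<noteq> 1" using z_inv hat_of_nat[OF v0 y(2)] y(1) by auto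
    ultimately have z: "1 < z" "2 * z \<le> v" using hat_bound[of v k] by (auto simp: z_def)
    have "hat v (k * int y) = hat v (int 1)" using k by (intro hat_cong) (simp add: mult.commute)
    also have "\<dots> = 1" using y v0 by (intro hat_of_nat) simp_all
    finally have "image_mset (\<lambda>l. hat v (k * int l)) (replicate_mset a 1 + replicate_mset c y) =
        replicate_mset c 1 + replicate_mset a z"
      by (simp add: z_def)
    \<comment> \<open>From \<open>a < y\<close> follows \<open>c >= v - y\<close>, and
      \<open>z\<close> and \<open>y\<close> are at most half of \<open>v\<close>, so
      \<open>c >= z\<close>.\<close>
    moreover have "realizable (replicate_mset c 1 + replicate_mset a z)"
      using False y(2) z v by (intro direct) simp_all
    ultimately have "realizable (image_mset (\<lambda>l. hat v (k * int l))
        (replicate_mset a 1 + replicate_mset c y))"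
      by (simp only:)
    then show ?thesis
    proof (rule realizable_unscale)
      show "v = size (replicate_mset a 1 + replicate_mset c y) + 1" using v by simp
      fix l assume "l \<in># replicate_mset a 1 + replicate_mset c y"
      then have "l = 1 \<or> l = y" by (auto split: if_splits)
      then show "2 * l \<le> v" using y(1,2) by linarith
    qed (rule k)
  qed
qed

lemma realizable_three:
  assumes "1 < x" "x < y" "2 * y \<le> v" "v = a + b + c + 1" "f x y \<le> a"
  shows "realizable (replicate_mset a 1 + replicate_mset b x + replicate_mset c y)"
proof (rule realizable_if_linear_realizable)
  show "linear_realizable (replicate_mset a 1 + replicate_mset b x + replicate_mset c y)"
    using assms(1,2,5) by (rule linear_realizable_three)
  fix l assume "l \<in># replicate_mset a 1 + replicate_mset b x + replicate_mset c y"
  then have "l = 1 \<or> l = x \<or> l = y" by (auto split: if_splits)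
  then have "2 * l \<le> v" using assms(1-3) by linarith
  then show "2 * l \<le> Suc (size (replicate_mset a 1 + replicate_mset b x + replicate_mset c y))"
    using assms(4) by simp
qed

text \<open>The length \<open>x\<close> takes over the role of 1. The order of the other two images
  is not known in advance, hence \<open>min\<close> and \<open>max\<close>.\<close>

lemma realizable_three_scaled:
  assumes k: "[k' * k = 1] (mod int v)" and v: "v = a + b + c + 1"
    and small: "2 * x \<le> v" "2 * y \<le> v" "2 * z \<le> v"
    and distinct: "x \<noteq> 0" "y \<noteq> 0" "z \<noteq> 0" "x \<noteq> y" "x \<noteq> z" "y \<noteq> z"
    and x: "hat v (k * int x) = 1"
    and a: "f (min (hat v (k * int y)) (hat v (k * int z))) (max (hat v (k * int y)) (hat v (k * int z))) \<le> a"
  shows "realizable (replicate_mset a x + replicate_mset b y + replicate_mset c z)"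
proof -
  define y' z' where "y' = hat v (k * int y)" and "z' = hat v (k * int z)"
  have v0: "0 < v" by (simp add: v)
  have inv: "hat v (k' * int 1) = x" "hat v (k' * int y') = y" "hat v (k' * int z') = z"
    using hat_inverse[OF v0 k] small x unfolding y'_def z'_def by metis+
  have "hat v 0 = 0" by (simp add: hat_def)
  \<comment> \<open>Scaling back by \<open>k'\<close> is a function sending 0, 1, \<open>y'\<close>,
    \<open>z'\<close> to 0, \<open>x\<close>, \<open>y\<close>, \<open>z\<close>, so a coincidence
    among the former would give one among the latter.\<close>
  then have "y' \<noteq> 0" "z' \<noteq> 0" using inv distinct by (metis mult_zero_right of_nat_0)+
  moreover have "y' \<noteq> 1" "z' \<noteq> 1" "y' \<noteq> z'" using inv distinct by metis+
  ultimately have gt: "1 < y'" "1 < z'" "y' \<noteq> z'" by auto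
  have bound: "2 * y' \<le> v" "2 * z' \<le> v" by (simp_all add: y'_def z'_def hat_bound)
  have "realizable (replicate_mset a 1 + replicate_mset b y' + replicate_mset c z')"
  proof (cases "y' < z'")
    case True
    then show ?thesis
      using gt bound v a by (intro realizable_three[of _ _ v]) (simp_all add: y'_def z'_def)
  next
    case False
    then have "z' < y'" using gt by simp
    then have "realizable (replicate_mset a 1 + replicate_mset c z' + replicate_mset b y')"
      using gt bound v a by (intro realizable_three[of _ _ v]) (simp_all add: y'_def z'_def)
    then show ?thesis by (simp only: ac_simps)
  qed
  then have "realizable (image_mset (\<lambda>l. hat v (k * int l))
      (replicate_mset a x + replicate_mset b y + replicate_mset c z))"
    using x by (simp add: y'_def z'_def)
  then show ?thesis
  proof (rule realizable_unscale)
    show "v = size (replicate_mset a x + replicate_mset b y + replicate_mset c z) + 1"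
      using v by simp
    fix l assume "l \<in># replicate_mset a x + replicate_mset b y + replicate_mset c z"
    then have "l = x \<or> l = y \<or> l = z" by (auto split: if_splits)
    then show "2 * l \<le> v" using small by blast
  qed (rule k)
qed

theorem theorem3p6:
  fixes x y a b c v x1 y1 x2 y2 :: nat and L :: "nat multiset"
  assumes "1 < x" and "x < y"
    and "v = a + b + c + 1"
    and "L = replicate_mset a 1 + replicate_mset b x + replicate_mset c y"
    and "strongly_admissible L"
    and "x1 = min (hat v (inv_mod v x * int y)) (hat v (inv_mod v x))"
    and "y1 = max (hat v (inv_mod v x * int y)) (hat v (inv_mod v x))"
    and "x2 = min (hat v (inv_mod v y)) (hat v (int x * inv_mod v y))"
    and "y2 = max (hat v (inv_mod v y)) (hat v (int x * inv_mod v y))"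
  shows "(a \<ge> f x y \<or> b \<ge> f x1 y1 \<or> c \<ge> f x2 y2 \<longrightarrow> realizable L) \<and>
         (\<not> realizable L \<longrightarrow> f x y + f x1 y1 + f x2 y2 \<ge> v + 2)"
proof -
  note L = assms(4)
  have size_L: "v = size L + 1" using assms(3) by (simp add: L)
  have unit: "2 * z \<le> v \<and> coprime z v" if "z \<in># L" for z
  proof -
    have "set_mset L \<subseteq> {1..v div 2}" "\<forall>z\<in>#L. gcd v z = 1"
      using assms(5) unfolding strongly_admissible_def size_L[symmetric] Let_def by blast+
    with that have "z \<in> {1..v div 2}" "gcd v z = 1" by blast+
    then have "coprime v z" by (intro gcd_eq_1_imp_coprime)
    with \<open>z \<in> {1..v div 2}\<close> show ?thesis by (auto simp: coprime_commute)
  qed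
  have x_unit: "2 * x \<le> v \<and> coprime x v" if "b \<noteq> 0" using that by (intro unit) (simp add: L)
  have y_unit: "2 * y \<le> v \<and> coprime y v" if "c \<noteq> 0" using that by (intro unit) (simp add: L)
  have "realizable L" if *: "a \<ge> f x y \<or> b \<ge> f x1 y1 \<or> c \<ge> f x2 y2"
  proof -
    \<comment> \<open>An absent length is not constrained by strong admissibility and may have no
      inverse modulo \<open>v\<close>. In that case at most two lengths remain, and
      \<open>realizable_two\<close> or a path of unit steps applies.\<close>
    consider "b = 0" "c = 0" | "b \<noteq> 0" "c = 0" | "b = 0" "c \<noteq> 0" | "b \<noteq> 0" "c \<noteq> 0" by blast
    then show ?thesis
    proof cases
      case 1
      have "linear_realizable (replicate_mset a 1)"
        using std_path_upt[of "Suc a"] unfolding std_path_def linear_realizable_def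
        by (metis One_nat_def Suc_le_mono diff_Suc_1 le0)
      then show ?thesis
        using 1 unfolding L by (intro realizable_if_linear_realizable) (simp_all split: if_splits)
    next
      case 2
      have "realizable (replicate_mset a 1 + replicate_mset b x)"
        using 2 x_unit assms(1,3) by (intro realizable_two[of x v]) simp_all
      then show ?thesis using 2 by (simp add: L)
    next
      case 3
      have "realizable (replicate_mset a 1 + replicate_mset c y)"
        using 3 y_unit assms(1-3) by (intro realizable_two[of y v]) simp_all
      then show ?thesis using 3 by (simp add: L)
    next
      case 4
      have x: "2 * x \<le> v" "coprime x v" and y: "2 * y \<le> v" "coprime y v"
        using x_unit y_unit 4 by simp_all
      have inverse: "[int z * inv_mod v z = 1] (mod int v)" "hat v (inv_mod v z * int z) = 1"
        if "coprime z v" for z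
      proof -
        show "[int z * inv_mod v z = 1] (mod int v)"
          using that by (intro cong_modular_inverse1) simp
        then have "hat v (inv_mod v z * int z) = hat v (int 1)"
          by (intro hat_cong) (simp add: mult.commute)
        also have "\<dots> = 1" using x(1) assms(1) by (intro hat_of_nat) simp_all
        finally show "hat v (inv_mod v z * int z) = 1" .
      qed
      from * consider "a \<ge> f x y" | "b \<ge> f x1 y1" | "c \<ge> f x2 y2" by blast
      then show ?thesis
      proof cases
        case 1
        then show ?thesis using realizable_three assms(1-3) y(1) unfolding L by blast
      next
        case 2
        have "realizable (replicate_mset b x + replicate_mset c y + replicate_mset a 1)"
        proof (rule realizable_three_scaled[OF inverse(1)[OF x(2)] _ x(1) y(1)])
          show "hat v (inv_mod v x * int x) = 1" by (rule inverse(2)[OF x(2)])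
          show "f (min (hat v (inv_mod v x * int y)) (hat v (inv_mod v x * int 1)))
              (max (hat v (inv_mod v x * int y)) (hat v (inv_mod v x * int 1))) \<le> b"
            using 2 by (simp add: assms(6,7))
        qed (use x(1) assms(1-3) in simp_all)
        then show ?thesis by (simp only: L ac_simps)
      next
        case 3
        have "realizable (replicate_mset c y + replicate_mset a 1 + replicate_mset b x)"
        proof (rule realizable_three_scaled[OF inverse(1)[OF y(2)] _ y(1) _ x(1)])
          show "hat v (inv_mod v y * int y) = 1" by (rule inverse(2)[OF y(2)])
          show "f (min (hat v (inv_mod v y * int 1)) (hat v (inv_mod v y * int x)))
              (max (hat v (inv_mod v y * int 1)) (hat v (inv_mod v y * int x))) \<le> c"
            using 3 by (simp add: assms(8,9) mult.commute)
        qed (use x(1) assms(1-3) in simp_all)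
        then show ?thesis by (simp only: L ac_simps)
      qed
    qed
  qed
  \<comment> \<open>Otherwise each of \<open>a\<close>, \<open>b\<close>, \<open>c\<close> is at
    least one below its bound, while their sum is \<open>v - 1\<close>; so the three bounds add up
    to at least \<open>v - 1 + 3\<close>.\<close>
  moreover from this have "f x y + f x1 y1 + f x2 y2 \<ge> v + 2" if "\<not> realizable L"
    using that assms(3) by force
  ultimately show ?thesis by blast
qed

end
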